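(* Consider a sequence of semi-complete markets satisfying (i)--(iv) of the context for each $n$, such that $\{Y_n\}$ satisfies the large deviations assumption (v) with scaling $\{r_n\}$ and rate function $I$, and such that assumption (vi) on the limits $l<u$ of the essential infima and suprema of $Y_n$ holds. For $\tilde p^n\in(\underline b_n,\bar b_n)$ let $\hat q_n=\hat q_n(\tilde p^n)$ be the optimal purchase quantity defined in the context. Then: (1) Assume $l<0$ and let $\tilde p^n=d^n+p$ for some $l<p<0$. Then a) $\liminf_{n\to\infty}\hat q_n/r_n>0$; b) if there exists $y<p$ such that $I(y)<\infty$, then $\limsup_{n\to\infty}\hat q_n/r_n<\infty$. (2) Assume $u>0$ and let $\tilde p^n=d^n+p$ for some $0<p<u$. Then a) $\limsup_{n\to\infty}\hat q_n/r_n<0$; b) if there exists $y>p$ such that $I(y)<\infty$, then $\liminf_{n\to\infty}\hat q_n/r_n>-\infty$.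
   Context: Fix a finite horizon $T>0$ and a risk aversion $a>0$. Relative entropy: $H(\mathbb Q|\mathbb P)=E^{\mathbb Q}[\log(d\mathbb Q/d\mathbb P)]$. Interest rates are zero. For each $n\in\mathbb N$ there is a market on a complete filtered probability space $(\Omega^n,\mathcal F^n,\mathbb F^n,\mathbb P^n)$ (filtrations indexed by $[0,T]$) with: (i) $\mathbb F^n=\mathbb G^n\vee\mathbb H^n$, where $\mathbb G^n,\mathbb H^n$ satisfy the usual conditions and $\mathcal G^n_T,\mathcal H^n_T\subset\mathcal F^n$ are $\mathbb P^n$-independent. (ii) A finite-dimensional, $\mathbb G^n$-adapted, locally bounded $(\mathbb P^n,\mathbb G^n)$-semimartingale $S^n$; a unique probability $\mathbb Q^n_0\sim\mathbb P^n$ on $\mathcal G^n_T$ under which $S^n$ is a $\mathbb G^n$-local martingale and with $H(\mathbb Q^n_0|\mathbb P^n|_{\mathcal G^n_T})<\infty$; and every $\mathcal G^n_T$-measurable, $\mathbb Q^n_0$-integrable $\xi$ equals, a.s., the terminal value of a $(\mathbb Q_0^n,\mathbb G^n)$-martingale $x+\int_0^\cdot\Delta_u\,dS^n_u$ for a unique $x\in\mathbb R$ and some $\mathbb G^n$-predictable $S^n$-integrable $\Delta$. (iii) A claim $B_n=D_n+Y_n$ with $D_n$ $\mathcal G^n_T$-measurable, $Y_n$ $\mathcal H^n_T$-measurable. (iv) $E^{\mathbb Q^n_0}[|D_n|^{1+\epsilon}]<\infty$ for some $\epsilon>0$ (possibly depending on $n$), and $\Lambda_n(\lambda):=\log E^{\mathbb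 P^n}[e^{\lambda Y_n}]<\infty$ for all $\lambda\in\mathbb R$. Put $d^n=E^{\mathbb Q^n_0}[D_n]$ (the replication cost of $D_n$). Large deviations principle (LDP): real random variables $\xi_n$ on $(\Omega^n,\mathcal F^n,\mathbb P^n)$ have an LDP with good rate function $I:\mathbb R\to[0,\infty]$ and scaling $r_n$ if $r_n\to\infty$; each $\{y: I(y)\le s\}$, $s\ge0$, is compact; $\liminf_n\frac1{r_n}\log\mathbb P^n[\xi_n\in G]\ge-\inf_GI$ for every open $G\subset\mathbb R$; and $\limsup_n\frac1{r_n}\log\mathbb P^n[\xi_n\in F]\le-\inf_FI$ for every closed $F\subset\mathbb R$. Assumption (v): $\{Y_n\}$ satisfies the LDP with scaling $\{r_n\}$ and good rate function $I$ (not necessarily convex); $I(y)=0\Leftrightarrow y=0$; and there is $\delta>0$ such that $\limsup_n\frac1{r_n}\Lambda_n(\epsilon r_n)<\infty$ for $\epsilon=\pm\delta$. Assumption (vi): there exist $l<u$ (possibly infinite) with $\lim_n\operatorname{essinf}_{\mathbb P^n}(Y_n)=l$ and $\lim_n\operatorname{esssup}_{\mathbb P^n}(Y_n)=u$. The range of arbitrage-free prices in the $n$th market is $(\underline b_n,\bar b_n)$ with $\underline b_n=d^n+\operatorname{essinf}_{\mathbb P^n}(Y_n)$, $\bar b_n=d^n+\operatorname{esssup}_{\mathbb P^n}(Y_n)$. If $p\in(l,u)$, then $d^n+p\in(\underline b_n,\bar b_n)$ for all large $n$, and the limits are understood along such $n$. Optimal purchase quantity: for $\tilde p^n\in(\underline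 b_n,\bar b_n)$, $\hat q_n(\tilde p^n)$ is the unique minimizer over $q\in\mathbb R$ of $q(\tilde p^n-d^n)+\frac1a\Lambda_n(-qa)$ (the problem equivalent to maximizing the exponential investor's optimal utility after buying $q$ units of $B_n$ at unit price $\tilde p^n$); equivalently it is the unique real solution of $\tilde p^n-d^n=\dot\Lambda_n(-\hat q_na)$, with $\dot\Lambda_n$ the derivative of $\Lambda_n$. *)

theory Defs
  imports "HOL-Probability.Probability"
begin

section \<open>Stochastic calculus on a finite horizon\<close>

text \<open>A filtration indexed by \<open>[0, T]\<close> is a function from reals to measures of which only the
  \<open>\<sigma>\<close>-algebras at times in \<open>{0..T}\<close> matter. A real process is a function
  \<open>X :: real \<Rightarrow> 'a \<Rightarrow> real\<close> restricted to times in \<open>{0..T}\<close>; a \<open>d\<close>-dimensional process is a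
  function \<open>S :: nat \<Rightarrow> real \<Rightarrow> 'a \<Rightarrow> real\<close> of which only the components \<open>j < d\<close> matter, so that
  the dimension may vary along a sequence of markets. The probability \<open>N\<close> may live on a
  \<open>\<sigma>\<close>-algebra as small as that of \<open>G T\<close>.\<close>

definition filtration_on :: "real \<Rightarrow> 'a measure \<Rightarrow> (real \<Rightarrow> 'a measure) \<Rightarrow> bool" where
  "filtration_on T N G \<longleftrightarrow>
     (\<forall>t\<in>{0..T}. subalgebra N (G t)) \<and>
     (\<forall>s\<in>{0..T}. \<forall>t\<in>{s..T}. sets (G s) \<subseteq> sets (G t))"

definition usual_conditions :: "real \<Rightarrow> 'a measure \<Rightarrow> (real \<Rightarrow> 'a measure) \<Rightarrow> bool" where
  "usual_conditions T N G \<longleftrightarrow>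
     filtration_on T N G \<and>
     (\<forall>t\<in>{0..<T}. sets (G t) = (\<Inter>u\<in>{t<..T}. sets (G u))) \<and>
     null_sets N \<subseteq> sets (G 0)"

definition adapted :: "real \<Rightarrow> (real \<Rightarrow> 'a measure) \<Rightarrow> (real \<Rightarrow> 'a \<Rightarrow> real) \<Rightarrow> bool" where
  "adapted T G X \<longleftrightarrow> (\<forall>t\<in>{0..T}. X t \<in> borel_measurable (G t))"

definition cadlag_path :: "real \<Rightarrow> (real \<Rightarrow> real) \<Rightarrow> bool" where
  "cadlag_path T f \<longleftrightarrow>
     (\<forall>t\<in>{0..<T}. (f \<longlongrightarrow> f t) (at_right t)) \<and>
     (\<forall>t\<in>{0<..T}. \<exists>L. (f \<longlongrightarrow> L) (at_left t))"

definition cadlag_adapted ::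
  "real \<Rightarrow> 'a measure \<Rightarrow> (real \<Rightarrow> 'a measure) \<Rightarrow> (real \<Rightarrow> 'a \<Rightarrow> real) \<Rightarrow> bool" where
  "cadlag_adapted T N G X \<longleftrightarrow>
     adapted T G X \<and> (AE \<omega> in N. cadlag_path T (\<lambda>t. X t \<omega>))"

definition stopping_time_on :: "real \<Rightarrow> 'a measure \<Rightarrow> (real \<Rightarrow> 'a measure) \<Rightarrow> ('a \<Rightarrow> real) \<Rightarrow> bool" where
  "stopping_time_on T N G \<tau> \<longleftrightarrow>
     (\<forall>\<omega>\<in>space N. \<tau> \<omega> \<in> {0..T}) \<and>
     (\<forall>t\<in>{0..T}. {\<omega> \<in> space N. \<tau> \<omega> \<le> t} \<in> sets (G t))"

text \<open>On a closed horizon a localizing sequence must reach \<open>T\<close>, and not merely converge to it.\<close>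

definition localizing ::
  "real \<Rightarrow> 'a measure \<Rightarrow> (real \<Rightarrow> 'a measure) \<Rightarrow> (nat \<Rightarrow> 'a \<Rightarrow> real) \<Rightarrow> bool" where
  "localizing T N G \<tau> \<longleftrightarrow>
     (\<forall>k. stopping_time_on T N G (\<tau> k)) \<and>
     (\<forall>k. \<forall>\<omega>\<in>space N. \<tau> k \<omega> \<le> \<tau> (Suc k) \<omega>) \<and>
     (AE \<omega> in N. \<exists>k. \<tau> k \<omega> = T)"

definition stopped_increment :: "(real \<Rightarrow> 'a \<Rightarrow> real) \<Rightarrow> ('a \<Rightarrow> real) \<Rightarrow> real \<Rightarrow> 'a \<Rightarrow> real" where
  "stopped_increment X \<tau> t \<omega> = X (min t (\<tau> \<omega>)) \<omega> - X 0 \<omega>"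

definition martingale_on ::
  "real \<Rightarrow> 'a measure \<Rightarrow> (real \<Rightarrow> 'a measure) \<Rightarrow> (real \<Rightarrow> 'a \<Rightarrow> real) \<Rightarrow> bool" where
  "martingale_on T N G X \<longleftrightarrow>
     cadlag_adapted T N G X \<and>
     (\<forall>t\<in>{0..T}. integrable N (X t)) \<and>
     (\<forall>s\<in>{0..T}. \<forall>t\<in>{s..T}. AE \<omega> in N. real_cond_exp N (G s) (X t) \<omega> = X s \<omega>)"

text \<open>Localization is applied to \<open>X - X\<^sub>0\<close>, so no integrability of \<open>X\<^sub>0\<close> is imposed.\<close>

definition local_martingale ::
  "real \<Rightarrow> 'a measure \<Rightarrow> (real \<Rightarrow> 'a measure) \<Rightarrow> (real \<Rightarrow> 'a \<Rightarrow> real) \<Rightarrow> bool" where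
  "local_martingale T N G X \<longleftrightarrow>
     cadlag_adapted T N G X \<and>
     (\<exists>\<tau>. localizing T N G \<tau> \<and> (\<forall>k. martingale_on T N G (stopped_increment X (\<tau> k))))"

definition locally_bounded ::
  "real \<Rightarrow> 'a measure \<Rightarrow> (real \<Rightarrow> 'a measure) \<Rightarrow> (real \<Rightarrow> 'a \<Rightarrow> real) \<Rightarrow> bool" where
  "locally_bounded T N G X \<longleftrightarrow>
     (\<exists>\<tau>. localizing T N G \<tau> \<and>
        (\<forall>k. \<exists>C. AE \<omega> in N. \<forall>t\<in>{0..T}. \<bar>stopped_increment X (\<tau> k) t \<omega>\<bar> \<le> C))"

definition finite_variation_path :: "real \<Rightarrow> (real \<Rightarrow> real) \<Rightarrow> bool" where
  "finite_variation_path T f \<longleftrightarrow>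
     (\<exists>C. \<forall>m t. 0 \<le> t 0 \<longrightarrow> (\<forall>i<m. t i \<le> t (Suc i)) \<longrightarrow> t m \<le> T \<longrightarrow>
        (\<Sum>i<m. \<bar>f (t (Suc i)) - f (t i)\<bar>) \<le> (C::real))"

definition semimartingale ::
  "real \<Rightarrow> 'a measure \<Rightarrow> (real \<Rightarrow> 'a measure) \<Rightarrow> (real \<Rightarrow> 'a \<Rightarrow> real) \<Rightarrow> bool" where
  "semimartingale T N G X \<longleftrightarrow>
     cadlag_adapted T N G X \<and>
     (\<exists>L A. local_martingale T N G L \<and>
        cadlag_adapted T N G A \<and> (AE \<omega> in N. finite_variation_path T (\<lambda>t. A t \<omega>)) \<and>
        (AE \<omega> in N. \<forall>t\<in>{0..T}. X t \<omega> = L t \<omega> + A t \<omega>))"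

definition predictable_sigma :: "real \<Rightarrow> 'a measure \<Rightarrow> (real \<Rightarrow> 'a measure) \<Rightarrow> (real \<times> 'a) measure" where
  "predictable_sigma T N G =
     sigma ({0..T} \<times> space N)
       ({{0} \<times> A | A. A \<in> sets (G 0)} \<union>
        {{s<..t} \<times> A | s t A. 0 \<le> s \<and> s \<le> t \<and> t \<le> T \<and> A \<in> sets (G s)})"

definition predictable ::
  "real \<Rightarrow> 'a measure \<Rightarrow> (real \<Rightarrow> 'a measure) \<Rightarrow> (real \<Rightarrow> 'a \<Rightarrow> real) \<Rightarrow> bool" where
  "predictable T N G X \<longleftrightarrow> (\<lambda>(t, \<omega>). X t \<omega>) \<in> borel_measurable (predictable_sigma T N G)"

subsection \<open>The stochastic integral\<close>

text \<open>The integral is built in the usual three stages: elementary integrands; bounded predictable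
  integrands, as the smallest extension closed under bounded pointwise limits and uniform
  convergence in probability (ucp); and general predictable integrands, by truncation and convergence in
  the semimartingale (Emery) topology. Integrals run over \<open>(0, t]\<close>, so integrands at time 0
  are irrelevant.\<close>

definition elementary_data ::
  "real \<Rightarrow> 'a measure \<Rightarrow> (real \<Rightarrow> 'a measure) \<Rightarrow> nat \<Rightarrow> nat \<Rightarrow> (nat \<Rightarrow> real) \<Rightarrow>
   (nat \<Rightarrow> nat \<Rightarrow> 'a \<Rightarrow> real) \<Rightarrow> bool" where
  "elementary_data T N G d m t \<xi> \<longleftrightarrow>
     0 \<le> t 0 \<and> (\<forall>i<m. t i \<le> t (Suc i)) \<and> t m \<le> T \<and>
     (\<forall>i<m. \<forall>j<d. \<xi> i j \<in> borel_measurable (G (t i)) \<and>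
        (\<exists>C. \<forall>\<omega>\<in>space N. \<bar>\<xi> i j \<omega>\<bar> \<le> C))"

definition elementary_process ::
  "nat \<Rightarrow> (nat \<Rightarrow> real) \<Rightarrow> (nat \<Rightarrow> nat \<Rightarrow> 'a \<Rightarrow> real) \<Rightarrow> nat \<Rightarrow> real \<Rightarrow> 'a \<Rightarrow> real" where
  "elementary_process m t \<xi> j s \<omega> = (\<Sum>i<m. indicator {t i<..t (Suc i)} s * \<xi> i j \<omega>)"

definition elementary_integral ::
  "nat \<Rightarrow> (nat \<Rightarrow> real \<Rightarrow> 'a \<Rightarrow> real) \<Rightarrow> nat \<Rightarrow> (nat \<Rightarrow> real) \<Rightarrow> (nat \<Rightarrow> nat \<Rightarrow> 'a \<Rightarrow> real) \<Rightarrow>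
   real \<Rightarrow> 'a \<Rightarrow> real" where
  "elementary_integral d S m t \<xi> s \<omega> =
     (\<Sum>i<m. \<Sum>j<d. \<xi> i j \<omega> * (S j (min s (t (Suc i))) \<omega> - S j (min s (t i)) \<omega>))"

definition ucp_conv ::
  "real \<Rightarrow> 'a measure \<Rightarrow> (nat \<Rightarrow> real \<Rightarrow> 'a \<Rightarrow> real) \<Rightarrow> (real \<Rightarrow> 'a \<Rightarrow> real) \<Rightarrow> bool" where
  "ucp_conv T N X Z \<longleftrightarrow>
     (\<forall>\<epsilon>>0. (\<lambda>k. measure N {\<omega>\<in>space N. \<exists>t\<in>{0..T}. \<epsilon> < \<bar>X k t \<omega> - Z t \<omega>\<bar>}) \<longlonglongrightarrow> 0)"

inductive bounded_integral ::
  "real \<Rightarrow> 'a measure \<Rightarrow> (real \<Rightarrow> 'a measure) \<Rightarrow> nat \<Rightarrow> (nat \<Rightarrow> real \<Rightarrow> 'a \<Rightarrow> real) \<Rightarrow>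
   (nat \<Rightarrow> real \<Rightarrow> 'a \<Rightarrow> real) \<Rightarrow> (real \<Rightarrow> 'a \<Rightarrow> real) \<Rightarrow> bool"
  for T N G d S where
  elementary: "elementary_data T N G d m t \<xi> \<Longrightarrow>
     bounded_integral T N G d S (elementary_process m t \<xi>) (elementary_integral d S m t \<xi>)"
| limit: "\<lbrakk>\<And>k. bounded_integral T N G d S (H k) (X k);
     \<And>k j t \<omega>. j < d \<Longrightarrow> t \<in> {0<..T} \<Longrightarrow> \<omega> \<in> space N \<Longrightarrow> \<bar>H k j t \<omega>\<bar> \<le> C;
     \<And>j t \<omega>. j < d \<Longrightarrow> t \<in> {0<..T} \<Longrightarrow> \<omega> \<in> space N \<Longrightarrow> (\<lambda>k. H k j t \<omega>) \<longlonglongrightarrow> K j t \<omega>;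
     cadlag_adapted T N G Z; ucp_conv T N X Z\<rbrakk> \<Longrightarrow>
     bounded_integral T N G d S K Z"

text \<open>In the Emery topology it suffices to test against elementary integrands bounded by 1.
  Increments only are compared; the value at time 0 is fixed separately below.\<close>

definition emery_conv ::
  "real \<Rightarrow> 'a measure \<Rightarrow> (real \<Rightarrow> 'a measure) \<Rightarrow> (nat \<Rightarrow> real \<Rightarrow> 'a \<Rightarrow> real) \<Rightarrow>
   (real \<Rightarrow> 'a \<Rightarrow> real) \<Rightarrow> bool" where
  "emery_conv T N G X Z \<longleftrightarrow>
     (\<forall>\<epsilon>>0. \<forall>\<eta>>0. \<forall>\<^sub>F k in sequentially. \<forall>m t \<xi>.
        elementary_data T N G 1 m t \<xi> \<and> (\<forall>i<m. \<forall>\<omega>\<in>space N. \<bar>\<xi> i 0 \<omega>\<bar> \<le> 1) \<longrightarrow>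
        measure N {\<omega>\<in>space N. \<exists>s\<in>{0..T}.
          \<epsilon> < \<bar>elementary_integral 1 (\<lambda>_ u \<omega>. X k u \<omega> - Z u \<omega>) m t \<xi> s \<omega>\<bar>} \<le> \<eta>)"

definition truncate_integrand ::
  "nat \<Rightarrow> nat \<Rightarrow> (nat \<Rightarrow> real \<Rightarrow> 'a \<Rightarrow> real) \<Rightarrow> nat \<Rightarrow> real \<Rightarrow> 'a \<Rightarrow> real" where
  "truncate_integrand d k \<Delta> j t \<omega> =
     (if L2_set (\<lambda>i. \<Delta> i t \<omega>) {..<d} \<le> real k then \<Delta> j t \<omega> else 0)"

text \<open>\<open>\<Delta>\<close> is predictable and \<open>S\<close>-integrable, and \<open>Z\<close> is a version of
  \<open>\<integral>\<^sub>0 \<Delta> dS\<close>.\<close>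

definition stochastic_integral ::
  "real \<Rightarrow> 'a measure \<Rightarrow> (real \<Rightarrow> 'a measure) \<Rightarrow> nat \<Rightarrow> (nat \<Rightarrow> real \<Rightarrow> 'a \<Rightarrow> real) \<Rightarrow>
   (nat \<Rightarrow> real \<Rightarrow> 'a \<Rightarrow> real) \<Rightarrow> (real \<Rightarrow> 'a \<Rightarrow> real) \<Rightarrow> bool" where
  "stochastic_integral T N G d S \<Delta> Z \<longleftrightarrow>
     (\<forall>j<d. predictable T N G (\<Delta> j)) \<and>
     cadlag_adapted T N G Z \<and> (AE \<omega> in N. Z 0 \<omega> = 0) \<and>
     (\<exists>X. (\<forall>k. bounded_integral T N G d S (truncate_integrand d k \<Delta>) (X k)) \<and>
          emery_conv T N G X Z)"


section \<open>Semi-complete markets\<close>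

text \<open>\<open>Q\<close> is a probability on \<open>G T\<close>, equivalent there to \<open>P\<close>, under which \<open>S\<close> is a local
  martingale and with finite entropy relative to \<open>P\<close> restricted to \<open>G T\<close>. As the negative part
  of \<open>log (dQ/dP)\<close> is always \<open>Q\<close>-integrable, finiteness of the entropy is integrability
  (\<^const>\<open>KL_divergence\<close> itself is 0 for infinite entropy).\<close>

definition finite_entropy_martingale_measure ::
  "real \<Rightarrow> 'a measure \<Rightarrow> (real \<Rightarrow> 'a measure) \<Rightarrow> nat \<Rightarrow> (nat \<Rightarrow> real \<Rightarrow> 'a \<Rightarrow> real) \<Rightarrow>
   'a measure \<Rightarrow> bool" where
  "finite_entropy_martingale_measure T P G d S Q \<longleftrightarrow>
     prob_space Q \<and> sets Q = sets (G T) \<and>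
     absolutely_continuous (restr_to_subalg P (G T)) Q \<and>
     absolutely_continuous Q (restr_to_subalg P (G T)) \<and>
     (\<forall>j<d. local_martingale T Q G (S j)) \<and>
     integrable Q (entropy_density (exp 1) (restr_to_subalg P (G T)) Q)"

definition cumulant_gf :: "'a measure \<Rightarrow> ('a \<Rightarrow> real) \<Rightarrow> real \<Rightarrow> real" where
  "cumulant_gf P Y \<theta> = ln (\<integral>\<omega>. exp (\<theta> * Y \<omega>) \<partial>P)"

locale semi_complete_market = prob_space P + complete_measure P
  for T :: real
    and P :: "'a measure"
    and F G H :: "real \<Rightarrow> 'a measure"
    and d :: nat
    and S :: "nat \<Rightarrow> real \<Rightarrow> 'a \<Rightarrow> real"
    and Q\<^sub>0 :: "'a measure"
    and B D Y :: "'a \<Rightarrow> real" +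
  assumes filtration_F: "filtration_on T P F"
    and join: "t \<in> {0..T} \<Longrightarrow> sets (F t) = sigma_sets (space P) (sets (G t) \<union> sets (H t))"
    and usual_G: "usual_conditions T P G"
    and usual_H: "usual_conditions T P H"
    and indep: "indep_set (sets (G T)) (sets (H T))"
    and semimartingale_S: "j < d \<Longrightarrow> semimartingale T P G (S j)"
    and locally_bounded_S: "j < d \<Longrightarrow> locally_bounded T P G (S j)"
    and unique_Q\<^sub>0: "finite_entropy_martingale_measure T P G d S Q \<longleftrightarrow> Q = Q\<^sub>0"
    and representation:
      "\<xi> \<in> borel_measurable (G T) \<Longrightarrow> integrable Q\<^sub>0 \<xi> \<Longrightarrow>
       \<exists>!x::real. \<exists>\<Delta> Z. stochastic_integral T Q\<^sub>0 G d S \<Delta> Z \<and>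
          martingale_on T Q\<^sub>0 G (\<lambda>t \<omega>. x + Z t \<omega>) \<and>
          (AE \<omega> in Q\<^sub>0. \<xi> \<omega> = x + Z T \<omega>)"
    and claim: "\<omega> \<in> space P \<Longrightarrow> B \<omega> = D \<omega> + Y \<omega>"
    and D_measurable: "D \<in> borel_measurable (G T)"
    and Y_measurable: "Y \<in> borel_measurable (H T)"
    and D_moment: "\<exists>\<epsilon>>0. integrable Q\<^sub>0 (\<lambda>\<omega>. \<bar>D \<omega>\<bar> powr (1 + \<epsilon>))"
    and Y_exponential_moments: "integrable P (\<lambda>\<omega>. exp (\<theta> * Y \<omega>))"

definition replication_cost :: "'a measure \<Rightarrow> ('a \<Rightarrow> real) \<Rightarrow> real" where
  "replication_cost Q D = (\<integral>\<omega>. D \<omega> \<partial>Q)"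

definition purchase_objective ::
  "real \<Rightarrow> 'a measure \<Rightarrow> ('a \<Rightarrow> real) \<Rightarrow> real \<Rightarrow> real \<Rightarrow> real \<Rightarrow> real" where
  "purchase_objective a P Y c price q = q * (price - c) + cumulant_gf P Y (- q * a) / a"

text \<open>Here \<open>c\<close> is the replication cost. The minimizer exists and is unique when \<open>price\<close> lies strictly
  between \<open>c + essinf Y\<close> and \<open>c + esssup Y\<close>; other prices are not meaningful.\<close>

definition optimal_quantity ::
  "real \<Rightarrow> 'a measure \<Rightarrow> ('a \<Rightarrow> real) \<Rightarrow> real \<Rightarrow> real \<Rightarrow> real" where
  "optimal_quantity a P Y c price =
     (THE q. \<forall>q'. q' \<noteq> q \<longrightarrow>
        purchase_objective a P Y c price q < purchase_objective a P Y c price q')"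

definition essinf :: "'a measure \<Rightarrow> ('a \<Rightarrow> ereal) \<Rightarrow> ereal" where
  "essinf P f = - esssup P (\<lambda>\<omega>. - f \<omega>)"


section \<open>Large deviations\<close>

text \<open>The logarithm of a probability, with \<open>log 0 = -\<infinity>\<close> (whereas \<open>ln 0 = 0\<close> in HOL).\<close>

definition log_prob :: "real \<Rightarrow> ereal" where
  "log_prob x = (if x = 0 then -\<infinity> else ereal (ln x))"

definition large_deviations ::
  "(nat \<Rightarrow> 'a measure) \<Rightarrow> (nat \<Rightarrow> 'a \<Rightarrow> real) \<Rightarrow> (nat \<Rightarrow> real) \<Rightarrow> (real \<Rightarrow> ereal) \<Rightarrow> bool" where
  "large_deviations P \<xi> r I \<longleftrightarrow>
     (\<forall>n. \<xi> n \<in> borel_measurable (P n)) \<and>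
     filterlim r at_top sequentially \<and>
     (\<forall>y. 0 \<le> I y) \<and>
     (\<forall>s\<ge>0. compact {y. I y \<le> ereal s}) \<and>
     (\<forall>U. open U \<longrightarrow>
        - (INF y\<in>U. I y) \<le>
        liminf (\<lambda>n. log_prob (measure (P n) {\<omega>\<in>space (P n). \<xi> n \<omega> \<in> U}) / ereal (r n))) \<and>
     (\<forall>C. closed C \<longrightarrow>
        limsup (\<lambda>n. log_prob (measure (P n) {\<omega>\<in>space (P n). \<xi> n \<omega> \<in> C}) / ereal (r n)) \<le>
        - (INF y\<in>C. I y))"

definition ld_assumption ::
  "(nat \<Rightarrow> 'a measure) \<Rightarrow> (nat \<Rightarrow> 'a \<Rightarrow> real) \<Rightarrow> (nat \<Rightarrow> real) \<Rightarrow> (real \<Rightarrow> ereal) \<Rightarrow> bool" where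
  "ld_assumption P Y r I \<longleftrightarrow>
     large_deviations P Y r I \<and>
     (\<forall>y. I y = 0 \<longleftrightarrow> y = 0) \<and>
     (\<exists>\<delta>>0. \<forall>\<epsilon>\<in>{\<delta>, -\<delta>}.
        limsup (\<lambda>n. ereal (cumulant_gf (P n) (Y n) (\<epsilon> * r n) / r n)) < \<infinity>)"

end

theory Submission
  imports Defs
begin

text \<open>At price \<open>d n + p\<close> the purchase objective is an increasing
  function of \<open>M\<^sub>n(\<theta>) = E[exp (\<theta> (Y n - p))]\<close> at \<open>\<theta> = - q a\<close> (\<open>purchase_objective_eq\<close>), so the
  optimal quantity is \<open>- 1 / a\<close> times the minimizer of \<open>M\<^sub>n\<close>, and the task is to locate that
  minimizer on the scale \<open>r n\<close>. As soon as \<open>Y n\<close> charges both sides of \<open>p\<close>, the function \<open>M\<^sub>n\<close> is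
  strictly convex and tends to infinity at both ends, so its minimizer exists and is unique
  (\<open>optimal_quantity_minimizes\<close>). If \<open>p < 0\<close> and \<open>n\<close> is large, one side is charged because \<open>p\<close> lies above the
  limit of the essential infima, the other because \<open>Y n\<close> concentrates at \<open>0 > p\<close>.

  Keep \<open>p < 0\<close>. The large deviations upper bound and \<open>I > 0\<close> away from \<open>0\<close> make the event
  \<open>\<bar>Y n\<bar> \<ge> \<bar>p\<bar> / 2\<close> exponentially unlikely at rate \<open>r n\<close>. Off this event \<open>Y n - p\<close> stays between
  \<open>\<bar>p\<bar> / 2\<close> and \<open>3 \<bar>p\<bar> / 2\<close>. For a small \<open>\<epsilon>\<close>, the bound on the cumulant generating function at
  \<open>- \<delta> r n\<close> keeps the unlikely event negligible in \<open>M\<^sub>n(- \<epsilon> r n)\<close>, which therefore is at most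
  \<open>2 exp (- \<epsilon> r n \<bar>p\<bar> / 2)\<close>. For \<open>\<theta> > - \<epsilon> r n / 6\<close>, on the other hand, the likely event alone gives
  \<open>M\<^sub>n(\<theta>) \<ge> exp (- \<epsilon> r n \<bar>p\<bar> / 4) / 2\<close>, which is larger. So the minimizer is at most
  \<open>- \<epsilon> r n / 6\<close> (\<open>minimizers_below\<close>). If moreover \<open>I y < \<infinity>\<close> for some \<open>y < p\<close>, the large
  deviations lower bound gives an event of probability at least \<open>exp (- c r n)\<close> on which \<open>Y n\<close> is
  below \<open>p\<close> by a fixed margin; there \<open>exp (\<theta> (Y n - p))\<close> outweighs this probability once
  \<open>\<theta> < - K r n\<close>, and \<open>M\<^sub>n(\<theta>) > 1 = M\<^sub>n(0)\<close> (\<open>minimizers_above\<close>).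

  The case \<open>p > 0\<close> follows by reflection: \<open>- Y n\<close> satisfies the same assumptions with rate function
  \<open>y \<mapsto> I (- y)\<close>, and replacing \<open>(Y n, p)\<close> by \<open>(- Y n, - p)\<close> turns \<open>M\<^sub>n(\<theta>)\<close> into
  \<open>M\<^sub>n(- \<theta>)\<close>.\<close>

section \<open>The shifted moment generating function and its minimizer\<close>

definition shifted_mgf :: "'a measure \<Rightarrow> ('a \<Rightarrow> real) \<Rightarrow> real \<Rightarrow> real \<Rightarrow> real" where
  "shifted_mgf M Y p \<theta> = (\<integral>\<omega>. exp (\<theta> * (Y \<omega> - p)) \<partial>M)"

locale exponential_moments = prob_space M for M :: "'a measure" +
  fixes Y :: "'a \<Rightarrow> real"
  assumes measurable_Y [measurable]: "Y \<in> borel_measurable M"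
    and integrable_exp: "integrable M (\<lambda>\<omega>. exp (\<theta> * Y \<omega>))"
begin

lemma integrable_exp_shifted: "integrable M (\<lambda>\<omega>. exp (\<theta> * (Y \<omega> - p)))"
proof -
  have "(\<lambda>\<omega>. exp (\<theta> * (Y \<omega> - p))) = (\<lambda>\<omega>. exp (- \<theta> * p) * exp (\<theta> * Y \<omega>))"
    by (auto simp: fun_eq_iff algebra_simps simp flip: exp_add)
  then show ?thesis using integrable_exp[of \<theta>] by simp
qed

lemma shifted_mgf_eq: "shifted_mgf M Y p \<theta> = exp (- \<theta> * p) * (\<integral>\<omega>. exp (\<theta> * Y \<omega>) \<partial>M)"
proof -
  have "(\<lambda>\<omega>. exp (\<theta> * (Y \<omega> - p))) = (\<lambda>\<omega>. exp (- \<theta> * p) * exp (\<theta> * Y \<omega>))"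
    by (auto simp: fun_eq_iff algebra_simps simp flip: exp_add)
  then show ?thesis by (simp add: shifted_mgf_def)
qed

lemma shifted_mgf_0 [simp]: "shifted_mgf M Y p 0 = 1"
  by (simp add: shifted_mgf_def prob_space)

lemma integral_exp_pos: "(\<integral>\<omega>. exp (\<theta> * Y \<omega>) \<partial>M) > 0"
proof -
  have "(\<integral>\<omega>. exp (\<theta> * Y \<omega>) \<partial>M) \<noteq> 0"
    by (subst integral_nonneg_eq_0_iff_AE[OF integrable_exp]) auto
  moreover have "(\<integral>\<omega>. exp (\<theta> * Y \<omega>) \<partial>M) \<ge> 0" by simp
  ultimately show ?thesis by linarith
qed

lemma shifted_mgf_pos: "shifted_mgf M Y p \<theta> > 0"
  using integral_exp_pos by (simp add: shifted_mgf_eq)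

lemma shifted_mgf_ge:
  assumes "A \<in> events" and "\<And>\<omega>. \<omega> \<in> A \<Longrightarrow> b \<le> \<theta> * (Y \<omega> - p)"
  shows "exp b * prob A \<le> shifted_mgf M Y p \<theta>"
proof -
  have "exp b * prob A = (\<integral>\<omega>. exp b * indicator A \<omega> \<partial>M)"
    using assms(1) by (simp add: sets.sets_into_space Int_absorb2)
  also have "\<dots> \<le> shifted_mgf M Y p \<theta>"
    unfolding shifted_mgf_def
    using assms
    by (intro integral_mono integrable_exp_shifted integrable_mult_right integrable_real_indicator)
      (auto simp: indicator_def emeasure_eq_measure)
  finally show ?thesis .
qed

text \<open>The linear cost of the quantity \<open>q\<close> is absorbed into the exponent, so that minimizing over
  quantities becomes minimizing a moment generating function.\<close>
lemma purchase_objective_eq: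
  assumes "a \<noteq> 0"
  shows "purchase_objective a M Y c (c + p) q = ln (shifted_mgf M Y p (- q * a)) / a"
  using assms integral_exp_pos[of "- q * a"]
  by (simp add: purchase_objective_def cumulant_gf_def shifted_mgf_eq ln_mult field_simps)

lemma convex_shifted_mgf: "convex_on UNIV (shifted_mgf M Y p)"
proof (rule convex_onI)
  fix t x y :: real assume t: "0 < t" "t < 1"
  have "shifted_mgf M Y p ((1 - t) *\<^sub>R x + t *\<^sub>R y)
      \<le> (\<integral>\<omega>. (1 - t) * exp (x * (Y \<omega> - p)) + t * exp (y * (Y \<omega> - p)) \<partial>M)"
    unfolding shifted_mgf_def
  proof (intro integral_mono)
    fix \<omega>
    show "exp (((1 - t) *\<^sub>R x + t *\<^sub>R y) * (Y \<omega> - p))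
        \<le> (1 - t) * exp (x * (Y \<omega> - p)) + t * exp (y * (Y \<omega> - p))"
      using convex_onD[OF exp_convex, of t "x * (Y \<omega> - p)" "y * (Y \<omega> - p)"] t
      by (simp add: algebra_simps)
  qed (intro integrable_exp_shifted Bochner_Integration.integrable_add integrable_mult_right)+
  also have "\<dots> = (1 - t) * shifted_mgf M Y p x + t * shifted_mgf M Y p y"
    by (simp add: shifted_mgf_def integrable_exp_shifted)
  finally show "shifted_mgf M Y p ((1 - t) *\<^sub>R x + t *\<^sub>R y)
      \<le> (1 - t) * shifted_mgf M Y p x + t * shifted_mgf M Y p y" .
qed simp

text \<open>The defect in midpoint convexity is the expectation of the square of
  \<open>exp (x (Y - p) / 2) - exp (y (Y - p) / 2)\<close>, which vanishes only where \<open>Y = p\<close>.\<close>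
lemma shifted_mgf_strict_midpoint:
  assumes "\<not> (AE \<omega> in M. Y \<omega> = p)" and "x \<noteq> y"
  shows "2 * shifted_mgf M Y p ((x + y) / 2) < shifted_mgf M Y p x + shifted_mgf M Y p y"
proof -
  define g where "g z \<omega> = exp (z / 2 * (Y \<omega> - p))" for z \<omega>
  have sq: "g z \<omega> * g w \<omega> = exp ((z + w) / 2 * (Y \<omega> - p))" for z w \<omega>
    by (simp add: g_def algebra_simps add_divide_distrib flip: exp_add)
  have int: "integrable M (\<lambda>\<omega>. g z \<omega> * g w \<omega>)" for z w
    unfolding sq by (rule integrable_exp_shifted)
  have expand: "(g x \<omega> - g y \<omega>)\<^sup>2 = g x \<omega> * g x \<omega> + g y \<omega> * g y \<omega> - 2 * (g x \<omega> * g y \<omega>)" for \<omega>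
    by (simp add: power2_eq_square algebra_simps)
  have intd: "integrable M (\<lambda>\<omega>. (g x \<omega> - g y \<omega>)\<^sup>2)"
    unfolding expand by (intro Bochner_Integration.integrable_add
        Bochner_Integration.integrable_diff integrable_mult_right int)
  have "(\<integral>\<omega>. (g x \<omega> - g y \<omega>)\<^sup>2 \<partial>M)
      = shifted_mgf M Y p x + shifted_mgf M Y p y - 2 * shifted_mgf M Y p ((x + y) / 2)"
    unfolding expand using int[of x x] int[of y y] int[of x y]
    by (simp add: sq shifted_mgf_def)
  moreover have "(\<integral>\<omega>. (g x \<omega> - g y \<omega>)\<^sup>2 \<partial>M) \<noteq> 0"
  proof
    assume "(\<integral>\<omega>. (g x \<omega> - g y \<omega>)\<^sup>2 \<partial>M) = 0"
    then have "AE \<omega> in M. (g x \<omega> - g y \<omega>)\<^sup>2 = 0"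
      by (subst (asm) integral_nonneg_eq_0_iff_AE[OF intd]) auto
    then have "AE \<omega> in M. Y \<omega> = p"
      using assms(2) by (auto simp: g_def)
    with assms(1) show False by simp
  qed
  moreover have "(\<integral>\<omega>. (g x \<omega> - g y \<omega>)\<^sup>2 \<partial>M) \<ge> 0" by simp
  ultimately show ?thesis by (smt (verit))
qed

lemma prob_pos_margin:
  assumes "\<not> (AE \<omega> in M. Z \<omega> \<le> 0)" and [measurable]: "Z \<in> borel_measurable M"
  obtains \<eta> :: real where "\<eta> > 0" "prob {\<omega> \<in> space M. \<eta> \<le> Z \<omega>} > 0"
proof -
  have "\<exists>k::nat. prob {\<omega> \<in> space M. 1 / Suc k \<le> Z \<omega>} > 0"
  proof (rule ccontr)
    assume "\<nexists>k::nat. prob {\<omega> \<in> space M. 1 / Suc k \<le> Z \<omega>} > 0"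
    then have "prob {\<omega> \<in> space M. 1 / Suc k \<le> Z \<omega>} = 0" for k :: nat
      by (metis measure_nonneg order_less_le)
    then have "AE \<omega> in M. \<not> 1 / Suc k \<le> Z \<omega>" for k :: nat
      by (subst (asm) prob_eq_0) (auto elim: eventually_mono)
    then have "AE \<omega> in M. \<forall>k::nat. \<not> 1 / Suc k \<le> Z \<omega>"
      by (simp add: AE_all_countable)
    then have "AE \<omega> in M. Z \<omega> \<le> 0"
    proof eventually_elim
      case (elim \<omega>)
      then show ?case
        by (metis inverse_eq_divide less_imp_le not_le real_arch_inverse reals_Archimedean)
    qed
    with assms(1) show False by simp
  qed
  then show ?thesis using that by (metis of_nat_0_less_iff zero_less_Suc zero_less_divide_1_iff)
qed

text \<open>Mass strictly on both sides of \<open>p\<close> pushes the function above its value \<open>1\<close> at \<open>0\<close> outside a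
  compact interval, on which it attains its minimum by continuity.\<close>
lemma shifted_mgf_minimizer_exists:
  assumes below: "\<not> (AE \<omega> in M. Y \<omega> \<ge> p)" and above: "\<not> (AE \<omega> in M. Y \<omega> \<le> p)"
  obtains \<theta> where "\<And>\<theta>'. shifted_mgf M Y p \<theta> \<le> shifted_mgf M Y p \<theta>'"
proof -
  obtain \<eta>1 where \<eta>1: "\<eta>1 > 0" "prob {\<omega> \<in> space M. \<eta>1 \<le> Y \<omega> - p} > 0"
    using prob_pos_margin[of "\<lambda>\<omega>. Y \<omega> - p"] above by auto
  obtain \<eta>2 where \<eta>2: "\<eta>2 > 0" "prob {\<omega> \<in> space M. \<eta>2 \<le> p - Y \<omega>} > 0"
    using prob_pos_margin[of "\<lambda>\<omega>. p - Y \<omega>"] below by auto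
  have gt1: "shifted_mgf M Y p \<theta> > 1"
    if A: "A \<in> events" "prob A > 0" and "\<And>\<omega>. \<omega> \<in> A \<Longrightarrow> b \<le> \<theta> * (Y \<omega> - p)" "b > - ln (prob A)"
    for A b \<theta>
  proof -
    have "1 = exp (- ln (prob A)) * prob A" using A by (simp add: exp_minus)
    also have "\<dots> < exp b * prob A" using that by simp
    also have "\<dots> \<le> shifted_mgf M Y p \<theta>" using that by (intro shifted_mgf_ge)
    finally show ?thesis .
  qed
  define R where "R = Max {0, - ln (prob {\<omega> \<in> space M. \<eta>1 \<le> Y \<omega> - p}) / \<eta>1,
    - ln (prob {\<omega> \<in> space M. \<eta>2 \<le> p - Y \<omega>}) / \<eta>2}"
  have R: "R \<ge> 0" "- ln (prob {\<omega> \<in> space M. \<eta>1 \<le> Y \<omega> - p}) / \<eta>1 \<le> R"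
    "- ln (prob {\<omega> \<in> space M. \<eta>2 \<le> p - Y \<omega>}) / \<eta>2 \<le> R"
    unfolding R_def by (auto intro!: Max_ge simp del: Max_insert)
  have outside: "shifted_mgf M Y p \<theta> > 1" if "\<theta> \<notin> {-R..R}" for \<theta>
  proof (cases "\<theta> > R")
    case True
    show ?thesis
    proof (rule gt1[of "{\<omega> \<in> space M. \<eta>1 \<le> Y \<omega> - p}" "\<theta> * \<eta>1"])
      have "- ln (prob {\<omega> \<in> space M. \<eta>1 \<le> Y \<omega> - p}) \<le> R * \<eta>1"
        using R(2) \<eta>1(1) by (subst (asm) pos_divide_le_eq)
      also have "\<dots> < \<theta> * \<eta>1" using True \<eta>1 by simp
      finally show "- ln (prob {\<omega> \<in> space M. \<eta>1 \<le> Y \<omega> - p}) < \<theta> * \<eta>1" .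
    qed (use \<eta>1 R True in \<open>auto intro!: mult_left_mono\<close>)
  next
    case False
    then have neg: "- \<theta> > R" using that by auto
    show ?thesis
    proof (rule gt1[of "{\<omega> \<in> space M. \<eta>2 \<le> p - Y \<omega>}" "- \<theta> * \<eta>2"])
      have "- ln (prob {\<omega> \<in> space M. \<eta>2 \<le> p - Y \<omega>}) \<le> R * \<eta>2"
        using R(3) \<eta>2(1) by (subst (asm) pos_divide_le_eq)
      also have "\<dots> < - \<theta> * \<eta>2" using neg \<eta>2 by (intro mult_strict_right_mono)
      finally show "- ln (prob {\<omega> \<in> space M. \<eta>2 \<le> p - Y \<omega>}) < - \<theta> * \<eta>2" .
      fix \<omega> assume "\<omega> \<in> {\<omega> \<in> space M. \<eta>2 \<le> p - Y \<omega>}"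
      then have "- \<theta> * \<eta>2 \<le> - \<theta> * (p - Y \<omega>)"
        using neg R by (intro mult_left_mono) auto
      then show "- \<theta> * \<eta>2 \<le> \<theta> * (Y \<omega> - p)" by (simp add: algebra_simps)
    qed (use \<eta>2 in auto)
  qed
  have "continuous_on {-R..R} (shifted_mgf M Y p)"
    using convex_on_continuous[OF open_UNIV convex_shifted_mgf] continuous_on_subset by blast
  then obtain \<theta> where \<theta>: "\<forall>\<theta>'\<in>{-R..R}. shifted_mgf M Y p \<theta> \<le> shifted_mgf M Y p \<theta>'"
    using continuous_attains_inf[of "{-R..R}" "shifted_mgf M Y p"] R(1) by auto
  have "shifted_mgf M Y p \<theta> \<le> shifted_mgf M Y p \<theta>'" for \<theta>'
  proof (cases "\<theta>' \<in> {-R..R}")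
    case False
    have "shifted_mgf M Y p \<theta> \<le> shifted_mgf M Y p 0" using bspec[OF \<theta>, of 0] R(1) by simp
    also have "\<dots> < shifted_mgf M Y p \<theta>'" using outside[OF False] by simp
    finally show ?thesis by simp
  qed (use \<theta> in auto)
  then show ?thesis using that by blast
qed

lemma shifted_mgf_minimizer_strict:
  assumes "\<not> (AE \<omega> in M. Y \<omega> = p)"
    and min: "\<And>\<theta>'. shifted_mgf M Y p \<theta> \<le> shifted_mgf M Y p \<theta>'" and "\<theta>' \<noteq> \<theta>"
  shows "shifted_mgf M Y p \<theta> < shifted_mgf M Y p \<theta>'"
  using shifted_mgf_strict_midpoint[OF assms(1), of \<theta> \<theta>'] min[of "(\<theta> + \<theta>') / 2"] assms(3)
  by (smt (verit))

lemma optimal_quantity_minimizes: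
  assumes "a > 0" and below: "\<not> (AE \<omega> in M. Y \<omega> \<ge> p)" and above: "\<not> (AE \<omega> in M. Y \<omega> \<le> p)"
  shows "shifted_mgf M Y p (- optimal_quantity a M Y c (c + p) * a) \<le> shifted_mgf M Y p \<theta>"
proof -
  obtain \<theta>0 where \<theta>0: "\<And>\<theta>'. shifted_mgf M Y p \<theta>0 \<le> shifted_mgf M Y p \<theta>'"
    using shifted_mgf_minimizer_exists[OF below above] by blast
  have ne: "\<not> (AE \<omega> in M. Y \<omega> = p)"
  proof
    assume "AE \<omega> in M. Y \<omega> = p"
    then have "AE \<omega> in M. Y \<omega> \<ge> p" by eventually_elim simp
    with below show False by simp
  qed
  define q where "q = - \<theta>0 / a"
  have q: "- q * a = \<theta>0" using \<open>a > 0\<close> by (simp add: q_def)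
  have strict: "purchase_objective a M Y c (c + p) q < purchase_objective a M Y c (c + p) q'"
    if "q' \<noteq> q" for q'
  proof -
    have "- q' * a \<noteq> \<theta>0" using that q \<open>a > 0\<close> by auto
    then have "shifted_mgf M Y p \<theta>0 < shifted_mgf M Y p (- q' * a)"
      using shifted_mgf_minimizer_strict[OF ne \<theta>0] by blast
    then show ?thesis
      using \<open>a > 0\<close> q shifted_mgf_pos[of p]
      by (simp add: purchase_objective_eq divide_strict_right_mono)
  qed
  have "optimal_quantity a M Y c (c + p) = q"
    unfolding optimal_quantity_def
      proof (rule the_equality)
    show "\<forall>q'. q' \<noteq> q \<longrightarrow>
        purchase_objective a M Y c (c + p) q < purchase_objective a M Y c (c + p) q'"
      using strict by blast
    show "q'' = q" if "\<forall>q'. q' \<noteq> q'' \<longrightarrow>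
        purchase_objective a M Y c (c + p) q'' < purchase_objective a M Y c (c + p) q'" for q''
      using that strict less_asym by metis
  qed
  with q \<theta>0 show ?thesis by simp
qed

lemma AE_ge_imp_essinf_ge:
  "(AE \<omega> in M. p \<le> Y \<omega>) \<Longrightarrow> ereal p \<le> essinf M (\<lambda>\<omega>. ereal (Y \<omega>))"
proof -
  assume "AE \<omega> in M. p \<le> Y \<omega>"
  then have "esssup M (\<lambda>\<omega>. - ereal (Y \<omega>)) \<le> - ereal p"
    by (intro esssup_I) auto
  then show ?thesis
    unfolding essinf_def by (metis ereal_uminus_le_reorder ereal_minus_le_minus ereal_uminus_uminus)
qed

text \<open>An exponential moment of higher order controls the contribution of an unlikely event to a
  lower one. The bound integrates the convexity of the exponential in the form
  \<open>exp (t v) \<le> exp (t b) ((1 - t) + t exp (v - b))\<close>. The level \<open>b\<close> is free: choosing it well above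
  the logarithm of the higher moment makes the second term small, while the first one carries the
  probability of the event.\<close>
lemma integral_exp_on_event_le:
  assumes A: "A \<in> events" and t: "0 \<le> t" "t \<le> 1"
  shows "(\<integral>\<omega>. exp (t * \<theta> * Y \<omega>) * indicator A \<omega> \<partial>M)
    \<le> (1 - t) * exp (t * b) * prob A + t * exp (t * b - b) * (\<integral>\<omega>. exp (\<theta> * Y \<omega>) \<partial>M)"
proof -
  have [simp]: "integrable M (\<lambda>\<omega>. indicator A \<omega> :: real)" "A \<inter> space M = A"
    using A by (auto simp: sets.sets_into_space Int_absorb2 emeasure_eq_measure intro!: integrable_real_indicator)
  have int: "integrable M (\<lambda>\<omega>. exp (t * \<theta> * Y \<omega>) * indicator A \<omega>)"
    using integrable_mult_indicator[OF A integrable_exp[of "t * \<theta>"]] by (simp add: mult.commute)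
  have "(\<integral>\<omega>. exp (t * \<theta> * Y \<omega>) * indicator A \<omega> \<partial>M)
      \<le> (\<integral>\<omega>. (1 - t) * exp (t * b) * indicator A \<omega> + t * exp (t * b - b) * exp (\<theta> * Y \<omega>) \<partial>M)"
  proof (rule integral_mono)
    fix \<omega> assume "\<omega> \<in> space M"
    have "exp (t * \<theta> * Y \<omega>) = exp (t * b) * exp ((1 - t) * 0 + t * (\<theta> * Y \<omega> - b))"
      by (simp add: algebra_simps flip: exp_add)
    also have "\<dots> \<le> exp (t * b) * ((1 - t) * exp 0 + t * exp (\<theta> * Y \<omega> - b))"
      using convex_onD[OF exp_convex, of t 0 "\<theta> * Y \<omega> - b"] t by simp
    also have "\<dots> = (1 - t) * exp (t * b) + t * (exp (t * b) * exp (\<theta> * Y \<omega> - b))"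
      by (simp add: algebra_simps)
    also have "exp (t * b) * exp (\<theta> * Y \<omega> - b) = exp (t * b - b) * exp (\<theta> * Y \<omega>)"
      by (simp add: algebra_simps flip: exp_add)
    finally show "exp (t * \<theta> * Y \<omega>) * indicator A \<omega>
        \<le> (1 - t) * exp (t * b) * indicator A \<omega> + t * exp (t * b - b) * exp (\<theta> * Y \<omega>)"
      using t by (auto simp: indicator_def mult.assoc)
  qed (use int integrable_exp[of \<theta>] in auto)
  also have "\<dots> = (1 - t) * exp (t * b) * prob A + t * exp (t * b - b) * (\<integral>\<omega>. exp (\<theta> * Y \<omega>) \<partial>M)"
    using integrable_exp[of \<theta>] by simp
  finally show ?thesis .
qed

end

section \<open>Exponential bounds from the large deviations principle\<close>

lemma log_prob_le:
  assumes "r > 0" "log_prob x / ereal r < ereal b" "x \<ge> 0"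
  shows "x \<le> exp (b * r)"
proof (cases "x = 0")
  case False
  with assms have "ln x / r < b" by (simp add: log_prob_def)
  then have "ln x \<le> b * r" using assms by (simp add: pos_divide_less_eq)
  then show ?thesis using False assms by (metis exp_le_cancel_iff exp_ln order_less_le)
qed simp

lemma log_prob_ge:
  assumes "r > 0" "ereal b < log_prob x / ereal r" "x \<ge> 0"
  shows "exp (b * r) \<le> x"
proof -
  have "x \<noteq> 0" using assms by (auto simp: log_prob_def divide_ereal_def)
  with assms have "b < ln x / r" by (simp add: log_prob_def)
  then have "b * r \<le> ln x" using assms by (simp add: pos_less_divide_eq)
  then show ?thesis using \<open>x \<noteq> 0\<close> assms by (metis exp_le_cancel_iff exp_ln order_less_le)
qed

text \<open>If the infimum over \<open>C\<close> were \<open>0\<close>, then the nested compact sets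
  \<open>C \<inter> {y. I y \<le> 1 / (k + 1)}\<close> would be nonempty and have a common point, a zero of \<open>I\<close>.\<close>
lemma good_rate_pos_on_closed:
  fixes I :: "real \<Rightarrow> ereal"
  assumes level: "\<And>s. s \<ge> 0 \<Longrightarrow> compact {y. I y \<le> ereal s}" and nonneg: "\<And>y. 0 \<le> I y"
    and "closed C" and pos: "\<And>y. y \<in> C \<Longrightarrow> I y \<noteq> 0"
  obtains \<kappa> :: real where "\<kappa> > 0" "\<And>y. y \<in> C \<Longrightarrow> ereal \<kappa> \<le> I y"
proof (rule ccontr)
  assume contra: "\<not> thesis"
  define K where "K k = C \<inter> {y. I y \<le> ereal (1 / Suc k)}" for k :: nat
  have "\<Inter> (range K) \<noteq> {}"
  proof (rule compact_nest)
    show "compact (K k)" for k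
      unfolding K_def using level \<open>closed C\<close> by (simp add: closed_Int_compact)
    show "K k \<noteq> {}" for k
    proof
      assume "K k = {}"
      then have "ereal (1 / Suc k) \<le> I y" if "y \<in> C" for y
        using that unfolding K_def by fastforce
      with contra that[of "1 / Suc k"] show False by simp
    qed
    show "K n \<subseteq> K m" if "m \<le> n" for m n
    proof -
      have "1 / real (Suc n) \<le> 1 / real (Suc m)" using that by (simp add: field_simps)
      then show ?thesis unfolding K_def by (auto intro: order_trans)
    qed
  qed
  then obtain y where y: "y \<in> C" "\<And>k. I y \<le> ereal (1 / Suc k)" unfolding K_def by auto
  have "I y \<le> 0"
  proof (rule LIMSEQ_le_const)
    show "(\<lambda>k. ereal (1 / Suc k)) \<longlonglongrightarrow> 0"
      using LIMSEQ_inverse_real_of_nat by (simp add: inverse_eq_divide zero_ereal_def)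
  qed (use y in auto)
  with pos[OF y(1)] nonneg[of y] show False by simp
qed

lemma closed_exp_small:
  assumes ld: "ld_assumption P Y r I" and "closed C" "0 \<notin> C"
  obtains \<kappa> :: real where "\<kappa> > 0"
    "\<forall>\<^sub>F n in sequentially. measure (P n) {\<omega> \<in> space (P n). Y n \<omega> \<in> C} \<le> exp (- \<kappa> * r n)"
proof -
  from ld have L: "large_deviations P Y r I" and I0: "\<And>y. I y = 0 \<longleftrightarrow> y = 0"
    by (auto simp: ld_assumption_def)
  obtain \<kappa> where \<kappa>: "\<kappa> > 0" "\<And>y. y \<in> C \<Longrightarrow> ereal \<kappa> \<le> I y"
    using good_rate_pos_on_closed[of I C] L I0 \<open>closed C\<close> \<open>0 \<notin> C\<close>
    unfolding large_deviations_def by metis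
  have "limsup (\<lambda>n. log_prob (measure (P n) {\<omega> \<in> space (P n). Y n \<omega> \<in> C}) / ereal (r n))
      \<le> - (INF y\<in>C. I y)"
    using L \<open>closed C\<close> by (simp add: large_deviations_def)
  also have "\<dots> \<le> - ereal \<kappa>"
    using \<kappa> by (subst ereal_minus_le_minus) (auto intro: INF_greatest)
  also have "\<dots> < ereal (- (\<kappa> / 2))" using \<kappa> by simp
  finally have "\<forall>\<^sub>F n in sequentially.
      log_prob (measure (P n) {\<omega> \<in> space (P n). Y n \<omega> \<in> C}) / ereal (r n) < ereal (- (\<kappa> / 2))"
    by (rule Limsup_lessD)
  moreover have "\<forall>\<^sub>F n in sequentially. r n > 0"
    using L by (auto simp: large_deviations_def filterlim_at_top_dense)
  ultimately have "\<forall>\<^sub>F n in sequentially.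
      measure (P n) {\<omega> \<in> space (P n). Y n \<omega> \<in> C} \<le> exp (- (\<kappa> / 2) * r n)"
    by eventually_elim (rule log_prob_le, simp_all)
  with \<kappa>(1) show ?thesis using that[of "\<kappa> / 2"] by simp
qed

lemma open_exp_large:
  assumes L: "large_deviations P Y r I" and "open U" "y \<in> U" "I y < \<infinity>"
  obtains c :: real where
    "\<forall>\<^sub>F n in sequentially. exp (- c * r n) \<le> measure (P n) {\<omega> \<in> space (P n). Y n \<omega> \<in> U}"
proof -
  have "0 \<le> I y" using L by (simp add: large_deviations_def)
  with \<open>I y < \<infinity>\<close> obtain i where i: "I y = ereal i" by (cases "I y") auto
  have "ereal (- (i + 1)) < - I y" using i by simp
  also have "\<dots> \<le> - (INF y\<in>U. I y)"
    using \<open>y \<in> U\<close> by (subst ereal_minus_le_minus) (auto intro: INF_lower)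
  also have "\<dots> \<le> liminf (\<lambda>n. log_prob (measure (P n) {\<omega> \<in> space (P n). Y n \<omega> \<in> U}) / ereal (r n))"
    using L \<open>open U\<close> by (simp add: large_deviations_def)
  finally have "\<forall>\<^sub>F n in sequentially.
      ereal (- (i + 1)) < log_prob (measure (P n) {\<omega> \<in> space (P n). Y n \<omega> \<in> U}) / ereal (r n)"
    by (rule less_LiminfD)
  moreover have "\<forall>\<^sub>F n in sequentially. r n > 0"
    using L by (auto simp: large_deviations_def filterlim_at_top_dense)
  ultimately have "\<forall>\<^sub>F n in sequentially.
      exp (- (i + 1) * r n) \<le> measure (P n) {\<omega> \<in> space (P n). Y n \<omega> \<in> U}"
    by eventually_elim (rule log_prob_ge, simp_all)
  then show ?thesis using that by blast
qed

section \<open>Reflection\<close>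

lemma large_deviations_uminus:
  assumes "large_deviations P Y r I"
  shows "large_deviations P (\<lambda>n \<omega>. - Y n \<omega>) r (\<lambda>y. I (- y))"
proof -
  have ev: "{\<omega> \<in> space (P n). - Y n \<omega> \<in> A} = {\<omega> \<in> space (P n). Y n \<omega> \<in> uminus ` A}" for n A
    by (auto simp: image_iff) (metis minus_minus)
  have INF: "(INF y\<in>A. I (- y)) = (INF y\<in>uminus ` A. I y)" for A
    by (simp add: image_image)
  have level: "{y. I (- y) \<le> ereal s} = uminus ` {y. I y \<le> ereal s}" for s
    by (auto simp: image_iff) (metis minus_minus)
  show ?thesis
    using assms unfolding large_deviations_def ev INF level
    by (simp add: compact_negations open_negations closed_negations)
qed

lemma ld_assumption_uminus:
  assumes "ld_assumption P Y r I"
  shows "ld_assumption P (\<lambda>n \<omega>. - Y n \<omega>) r (\<lambda>y. I (- y))"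
proof -
  have "cumulant_gf M (\<lambda>\<omega>. - Z \<omega>) \<theta> = cumulant_gf M Z (- \<theta>)" for M :: "'a measure" and Z \<theta>
    by (simp add: cumulant_gf_def)
  then show ?thesis
    using assms large_deviations_uminus[of P Y r I] unfolding ld_assumption_def
    by (auto simp: neg_equal_0_iff_equal)
qed

lemma shifted_mgf_uminus: "shifted_mgf M (\<lambda>\<omega>. - Y \<omega>) (- p) \<theta> = shifted_mgf M Y p (- \<theta>)"
  by (simp add: shifted_mgf_def algebra_simps)

lemma exponential_moments_uminus:
  assumes "exponential_moments P Y"
  shows "exponential_moments P (\<lambda>\<omega>. - Y \<omega>)"
proof -
  interpret exponential_moments P Y by fact
  show ?thesis
  proof unfold_locales
    show "integrable P (\<lambda>\<omega>. exp (\<theta> * - Y \<omega>))" for \<theta> using integrable_exp[of "- \<theta>"] by simp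
  qed simp
qed

section \<open>Locating the minimizers\<close>

text \<open>This holds because an exponentially unlikely event contributes at most \<open>exp (\<epsilon> r n p)\<close> to the
  value at \<open>- \<epsilon> r n\<close>, while \<open>Y n - p\<close> is otherwise positive and bounded away from \<open>0\<close>: moving
  \<open>\<theta>\<close> from near \<open>0\<close> down to \<open>- \<epsilon> r n\<close> pays exponentially.\<close>
lemma minimizers_below:
  assumes em: "\<And>n. exponential_moments (P n) (Y n)" and ld: "ld_assumption P Y r I" and "p < 0"
  obtains \<epsilon> where "\<epsilon> > 0"
    "\<forall>\<^sub>F n in sequentially. \<forall>\<theta>.
      (\<forall>\<theta>'. shifted_mgf (P n) (Y n) p \<theta> \<le> shifted_mgf (P n) (Y n) p \<theta>') \<longrightarrow> \<theta> \<le> - \<epsilon> * r n"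
proof -
  from ld obtain \<delta> where \<delta>: "\<delta> > 0"
    "limsup (\<lambda>n. ereal (cumulant_gf (P n) (Y n) (- \<delta> * r n) / r n)) < \<infinity>"
    by (auto simp: ld_assumption_def)
  have rlim: "filterlim r at_top sequentially"
    using ld by (simp add: ld_assumption_def large_deviations_def)
  obtain C0 where "limsup (\<lambda>n. ereal (cumulant_gf (P n) (Y n) (- \<delta> * r n) / r n)) < ereal C0"
    using ereal_dense2[OF \<delta>(2)] by auto
  then have ev1: "\<forall>\<^sub>F n in sequentially. ereal (cumulant_gf (P n) (Y n) (- \<delta> * r n) / r n) < ereal C0"
    by (rule Limsup_lessD)
  define C where "C = max C0 1"
  have C: "C > 0" "C0 \<le> C" by (auto simp: C_def)
  define W where "W = {y. - p / 2 \<le> \<bar>y\<bar>}"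
  have "closed W" "0 \<notin> W"
    using \<open>p < 0\<close> by (auto simp: W_def intro!: closed_Collect_le continuous_intros)
  then obtain \<kappa> where \<kappa>: "\<kappa> > 0"
    "\<forall>\<^sub>F n in sequentially. measure (P n) {\<omega> \<in> space (P n). Y n \<omega> \<in> W} \<le> exp (- \<kappa> * r n)"
    using closed_exp_small[OF ld] by blast
  \<comment> \<open>The first bound on \<open>t\<close> controls the higher moment in \<open>integral_exp_on_event_le\<close>, the second lets
    the small probability beat the factor \<open>exp (t b)\<close> there, for the level \<open>b = 2 C r\<^sub>n\<close>.\<close>
  define t where "t = min (1 / 2) (\<kappa> / (2 * C))"
  have t: "t > 0" "t \<le> 1 / 2" "2 * t * C \<le> \<kappa>"
    using \<kappa> C by (auto simp: t_def min_def field_simps)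
  define \<epsilon> where "\<epsilon> = t * \<delta>"
  have \<epsilon>: "\<epsilon> > 0" using t \<delta> by (simp add: \<epsilon>_def)
  \<comment> \<open>The second entry makes the likely event have probability at least \<open>1 / 2\<close>; the third makes
    \<open>2 exp (\<epsilon> r\<^sub>n p / 2)\<close> smaller than \<open>exp (\<epsilon> r\<^sub>n p / 4) / 2\<close>.\<close>
  have "\<forall>\<^sub>F n in sequentially. r n > Max {0, ln 2 / \<kappa>, ln 4 * 4 / (\<epsilon> * - p)}"
    using rlim unfolding filterlim_at_top_dense by blast
  with ev1 \<kappa>(2) have "\<forall>\<^sub>F n in sequentially. \<forall>\<theta>.
      (\<forall>\<theta>'. shifted_mgf (P n) (Y n) p \<theta> \<le> shifted_mgf (P n) (Y n) p \<theta>') \<longrightarrow> \<theta> \<le> - (\<epsilon> / 6) * r n"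
  proof eventually_elim
    case (elim n)
    interpret exponential_moments "P n" "Y n" by (rule em)
    define A where "A = {\<omega> \<in> space (P n). Y n \<omega> \<in> W}"
    have A: "A \<in> events" unfolding A_def W_def by measurable
    have r: "r n > 0" "ln 2 / \<kappa> < r n" "ln 4 * 4 / (\<epsilon> * - p) < r n" using elim by auto
    have r2: "exp (- \<kappa> * r n) \<le> 1 / 2"
    proof -
      have "ln 2 \<le> \<kappa> * r n" using r \<kappa> by (simp add: pos_divide_less_eq mult.commute)
      then have "exp (- \<kappa> * r n) \<le> exp (- ln 2)" by simp
      then show ?thesis by (simp add: exp_minus)
    qed
    have A_small: "prob A \<le> exp (- \<kappa> * r n)" using elim by (simp add: A_def)
    have compl: "prob (space (P n) - A) \<ge> 1 / 2"
      using prob_compl[OF A] A_small r2 by linarith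
    have cgf: "(\<integral>\<omega>. exp (- \<delta> * r n * Y n \<omega>) \<partial>P n) \<le> exp (C * r n)"
    proof -
      have "cumulant_gf (P n) (Y n) (- \<delta> * r n) < C0 * r n"
        using elim r by (simp add: pos_divide_less_eq)
      also have "\<dots> \<le> C * r n" using C r by simp
      finally have "ln (\<integral>\<omega>. exp (- \<delta> * r n * Y n \<omega>) \<partial>P n) \<le> C * r n"
        by (simp add: cumulant_gf_def)
      then show ?thesis using integral_exp_pos[of "- \<delta> * r n"] by (metis exp_le_cancel_iff exp_ln)
    qed
    have tail: "(\<integral>\<omega>. exp (- \<epsilon> * r n * Y n \<omega>) * indicator A \<omega> \<partial>P n) \<le> 1"
    proof -
      define b where "b = 2 * C * r n"
      have "(\<integral>\<omega>. exp (- \<epsilon> * r n * Y n \<omega>) * indicator A \<omega> \<partial>P n)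
          \<le> (1 - t) * exp (t * b) * prob A + t * exp (t * b - b) * (\<integral>\<omega>. exp (- \<delta> * r n * Y n \<omega>) \<partial>P n)"
        using integral_exp_on_event_le[OF A, of t "- \<delta> * r n" b] t by (simp add: \<epsilon>_def mult.assoc)
      also have "\<dots> \<le> (1 - t) * exp (t * b) * exp (- \<kappa> * r n) + t * exp (t * b - b) * exp (C * r n)"
        using A_small cgf t by (intro add_mono mult_left_mono) auto
      also have "\<dots> = (1 - t) * exp (t * b - \<kappa> * r n) + t * exp (t * b - b + C * r n)"
        by (simp add: mult.assoc exp_diff exp_add exp_minus divide_inverse)
      also have "\<dots> \<le> (1 - t) * 1 + t * 1"
      proof (intro add_mono mult_left_mono)
        have "(2 * t * C) * r n \<le> \<kappa> * r n" using t r by (intro mult_right_mono) auto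
        then show "exp (t * b - \<kappa> * r n) \<le> 1" by (simp add: b_def algebra_simps)
        have "(2 * t) * (C * r n) \<le> 1 * (C * r n)" using t C r by (intro mult_right_mono) auto
        then show "exp (t * b - b + C * r n) \<le> 1" by (simp add: b_def algebra_simps)
      qed (use t in auto)
      finally show ?thesis by simp
    qed
    have upper: "shifted_mgf (P n) (Y n) p (- \<epsilon> * r n) \<le> 2 * exp (\<epsilon> * r n * p / 2)"
    proof -
      have int: "integrable (P n) (\<lambda>\<omega>. exp (- \<epsilon> * r n * Y n \<omega>) * indicator A \<omega>)"
        using integrable_mult_indicator[OF A integrable_exp[of "- \<epsilon> * r n"]]
        by (simp add: mult.commute)
      have "shifted_mgf (P n) (Y n) p (- \<epsilon> * r n)
          \<le> (\<integral>\<omega>. exp (\<epsilon> * r n * p / 2)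
              + exp (\<epsilon> * r n * p) * (exp (- \<epsilon> * r n * Y n \<omega>) * indicator A \<omega>) \<partial>P n)"
        unfolding shifted_mgf_def
      proof (rule integral_mono)
        fix \<omega> assume \<omega>: "\<omega> \<in> space (P n)"
        show "exp (- \<epsilon> * r n * (Y n \<omega> - p)) \<le> exp (\<epsilon> * r n * p / 2)
              + exp (\<epsilon> * r n * p) * (exp (- \<epsilon> * r n * Y n \<omega>) * indicator A \<omega>)"
        proof (cases "\<omega> \<in> A")
          case True
          then show ?thesis by (simp add: algebra_simps flip: exp_add)
        next
          case False
          then have "Y n \<omega> - p \<ge> - p / 2" using \<omega> by (auto simp: A_def W_def)
          then have "(\<epsilon> * r n) * (- p / 2) \<le> (\<epsilon> * r n) * (Y n \<omega> - p)"
            using \<epsilon> r by (intro mult_left_mono) auto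
          then show ?thesis using False by (simp add: algebra_simps)
        qed
      qed (use int integrable_exp_shifted[of "- \<epsilon> * r n" p] in auto)
      also have "\<dots> = exp (\<epsilon> * r n * p / 2)
          + exp (\<epsilon> * r n * p) * (\<integral>\<omega>. exp (- \<epsilon> * r n * Y n \<omega>) * indicator A \<omega> \<partial>P n)"
        using int by (simp add: prob_space)
      also have "\<dots> \<le> exp (\<epsilon> * r n * p / 2) + exp (\<epsilon> * r n * p) * 1"
        using tail by (intro add_left_mono mult_left_mono) auto
      also have "exp (\<epsilon> * r n * p) \<le> exp (\<epsilon> * r n * p / 2)"
        using \<epsilon> r \<open>p < 0\<close> by (simp add: mult_nonneg_nonpos)
      finally show ?thesis by simp
    qed
    have lower: "shifted_mgf (P n) (Y n) p \<theta> > 2 * exp (\<epsilon> * r n * p / 2)"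
      if \<theta>: "\<theta> > - (\<epsilon> / 6) * r n" for \<theta>
    proof -
      have "ln 4 * 4 < r n * (\<epsilon> * - p)"
        using r \<epsilon> \<open>p < 0\<close> by (subst (asm) pos_divide_less_eq) (auto simp: mult_pos_neg)
      then have "\<epsilon> * r n * p / 2 + ln 4 < \<epsilon> * r n * p / 4"
        by (simp add: algebra_simps)
      then have "exp (\<epsilon> * r n * p / 2 + ln 4) < exp (\<epsilon> * r n * p / 4)" by simp
      then have "2 * exp (\<epsilon> * r n * p / 2) < exp (\<epsilon> * r n * p / 4) * (1 / 2)"
        by (simp add: exp_add)
      also have "\<dots> \<le> exp (\<epsilon> * r n * p / 4) * prob (space (P n) - A)"
        using compl by (intro mult_left_mono) auto
      also have "\<dots> \<le> shifted_mgf (P n) (Y n) p \<theta>"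
      proof (rule shifted_mgf_ge)
        fix \<omega> assume "\<omega> \<in> space (P n) - A"
        then have Y: "0 \<le> Y n \<omega> - p" "Y n \<omega> - p \<le> - (3 / 2) * p" using \<open>p < 0\<close> by (auto simp: A_def W_def)
        have "\<epsilon> * r n * p / 4 = - ((\<epsilon> / 6) * r n * (- (3 / 2) * p))" by simp
        also have "\<dots> \<le> - ((\<epsilon> / 6) * r n * (Y n \<omega> - p))"
          using Y \<epsilon> r by (intro le_imp_neg_le mult_left_mono) auto
        also have "\<dots> = (- (\<epsilon> / 6) * r n) * (Y n \<omega> - p)" by simp
        also have "\<dots> \<le> \<theta> * (Y n \<omega> - p)" using Y \<theta> by (intro mult_right_mono) auto
        finally show "\<epsilon> * r n * p / 4 \<le> \<theta> * (Y n \<omega> - p)" .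
      qed (use A in auto)
      finally show ?thesis .
    qed
    show ?case
    proof (intro allI impI)
      fix \<theta> assume "\<forall>\<theta>'. shifted_mgf (P n) (Y n) p \<theta> \<le> shifted_mgf (P n) (Y n) p \<theta>'"
      then have "shifted_mgf (P n) (Y n) p \<theta> \<le> 2 * exp (\<epsilon> * r n * p / 2)"
        using upper order_trans by blast
      with lower[of \<theta>] show "\<theta> \<le> - (\<epsilon> / 6) * r n" by linarith
    qed
  qed
  then show ?thesis using that[of "\<epsilon> / 6"] \<epsilon> by simp
qed

text \<open>Finiteness of the rate at \<open>y\<close> means that \<open>Y n\<close> falls below \<open>p\<close> by a margin \<open>\<eta>\<close> with
  probability at least \<open>exp (- c r n)\<close>. For \<open>\<theta> < - K r n\<close> with \<open>K \<eta> \<ge> c\<close> this event alone pushes the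
  value above \<open>1\<close>, the value at \<open>0\<close>.\<close>
lemma minimizers_above:
  assumes em: "\<And>n. exponential_moments (P n) (Y n)" and ld: "large_deviations P Y r I"
    and y: "y < p" "I y < \<infinity>"
  obtains K where
    "\<forall>\<^sub>F n in sequentially. \<forall>\<theta>.
      (\<forall>\<theta>'. shifted_mgf (P n) (Y n) p \<theta> \<le> shifted_mgf (P n) (Y n) p \<theta>') \<longrightarrow> - K * r n \<le> \<theta>"
proof -
  define \<eta> where "\<eta> = (p - y) / 2"
  have \<eta>: "\<eta> > 0" "y < p - \<eta>" using y by (auto simp: \<eta>_def field_simps)
  obtain c where c: "\<forall>\<^sub>F n in sequentially.
      exp (- c * r n) \<le> measure (P n) {\<omega> \<in> space (P n). Y n \<omega> \<in> {..<p - \<eta>}}"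
    using open_exp_large[OF ld, of "{..<p - \<eta>}" y] \<eta> y by auto
  define K where "K = max 0 (c / \<eta>)"
  have K: "K \<ge> 0" "c \<le> K * \<eta>" using \<eta> by (auto simp: K_def max_def field_simps)
  have "\<forall>\<^sub>F n in sequentially. r n > 0"
    using ld by (auto simp: large_deviations_def filterlim_at_top_dense)
  with c have "\<forall>\<^sub>F n in sequentially. \<forall>\<theta>.
      (\<forall>\<theta>'. shifted_mgf (P n) (Y n) p \<theta> \<le> shifted_mgf (P n) (Y n) p \<theta>') \<longrightarrow> - K * r n \<le> \<theta>"
  proof eventually_elim
    case (elim n)
    interpret exponential_moments "P n" "Y n" by (rule em)
    define A where "A = {\<omega> \<in> space (P n). Y n \<omega> \<in> {..<p - \<eta>}}"
    have A: "A \<in> events" "exp (- c * r n) \<le> prob A" using elim by (auto simp: A_def)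
    have large: "shifted_mgf (P n) (Y n) p \<theta> > 1" if "\<theta> < - K * r n" for \<theta>
    proof -
      have \<theta>: "K * r n < - \<theta>" using that by simp
      have \<theta>0: "0 \<le> - \<theta>" using \<theta> mult_nonneg_nonneg[of K "r n"] K elim by linarith
      have "c * r n \<le> K * \<eta> * r n" using K elim by (intro mult_right_mono) auto
      also have "\<dots> = K * r n * \<eta>" by simp
      also have "\<dots> < - \<theta> * \<eta>" using \<theta> \<eta> by (intro mult_strict_right_mono)
      finally have "1 < exp (- \<theta> * \<eta> - c * r n)" by simp
      also have "\<dots> = exp (- \<theta> * \<eta>) * exp (- c * r n)" by (simp flip: exp_add)
      also have "\<dots> \<le> exp (- \<theta> * \<eta>) * prob A" using A by (intro mult_left_mono) auto
      also have "\<dots> \<le> shifted_mgf (P n) (Y n) p \<theta>"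
      proof (rule shifted_mgf_ge[OF A(1)])
        fix \<omega> assume "\<omega> \<in> A"
        then have "- \<theta> * \<eta> \<le> - \<theta> * (p - Y n \<omega>)"
          using \<theta>0 by (intro mult_left_mono) (auto simp: A_def)
        then show "- \<theta> * \<eta> \<le> \<theta> * (Y n \<omega> - p)" by (simp add: algebra_simps)
      qed
      finally show ?thesis .
    qed
    show ?case
    proof (intro allI impI)
      fix \<theta> assume "\<forall>\<theta>'. shifted_mgf (P n) (Y n) p \<theta> \<le> shifted_mgf (P n) (Y n) p \<theta>'"
      then have "shifted_mgf (P n) (Y n) p \<theta> \<le> 1" by (metis shifted_mgf_0)
      with large[of \<theta>] show "- K * r n \<le> \<theta>" by linarith
    qed
  qed
  then show ?thesis using that by blast
qed

text \<open>The mass of \<open>Y n\<close> concentrates at \<open>0\<close>, so it cannot stay below a negative level.\<close>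
lemma eventually_not_AE_le_neg:
  assumes em: "\<And>n. exponential_moments (P n) (Y n)" and ld: "ld_assumption P Y r I" and "p < 0"
  shows "\<forall>\<^sub>F n in sequentially. \<not> (AE \<omega> in P n. Y n \<omega> \<le> p)"
proof -
  obtain \<kappa> where \<kappa>: "\<kappa> > 0"
    "\<forall>\<^sub>F n in sequentially. measure (P n) {\<omega> \<in> space (P n). Y n \<omega> \<in> {..p}} \<le> exp (- \<kappa> * r n)"
    using closed_exp_small[OF ld, of "{..p}"] \<open>p < 0\<close> by auto
  have "\<forall>\<^sub>F n in sequentially. r n > 0"
    using ld by (auto simp: ld_assumption_def large_deviations_def filterlim_at_top_dense)
  with \<kappa>(2) show ?thesis
  proof eventually_elim
    case (elim n)
    interpret exponential_moments "P n" "Y n" by (rule em)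
    show ?case
    proof
      assume "AE \<omega> in P n. Y n \<omega> \<le> p"
      then have "prob {\<omega> \<in> space (P n). Y n \<omega> \<in> {..p}} = 1"
        by (subst prob_eq_1) (auto elim: eventually_mono)
      moreover have "exp (- \<kappa> * r n) < 1" using \<kappa> elim by simp
      ultimately show False using elim by linarith
    qed
  qed
qed

lemma eventually_not_AE_ge:
  assumes em: "\<And>n. exponential_moments (P n) (Y n)"
    and lim: "(\<lambda>n. essinf (P n) (\<lambda>\<omega>. ereal (Y n \<omega>))) \<longlonglongrightarrow> l" and "l < ereal p"
  shows "\<forall>\<^sub>F n in sequentially. \<not> (AE \<omega> in P n. Y n \<omega> \<ge> p)"
  using order_tendstoD(2)[OF lim \<open>l < ereal p\<close>]
  by eventually_elim (use exponential_moments.AE_ge_imp_essinf_ge[OF em] leD in blast)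

section \<open>Optimal quantities in semi-complete markets\<close>

lemma semi_complete_market_exponential_moments:
  assumes "semi_complete_market T P F G H d S Q\<^sub>0 B D Y" and "Y \<in> borel_measurable P"
  shows "exponential_moments P Y"
proof -
  interpret semi_complete_market T P F G H d S Q\<^sub>0 B D Y by fact
  show ?thesis by unfold_locales (use assms Y_exponential_moments in auto)
qed

theorem proposition4p8:
  fixes T a :: real
    and P Q\<^sub>0 :: "nat \<Rightarrow> 'a measure"
    and F G H :: "nat \<Rightarrow> real \<Rightarrow> 'a measure"
    and dim :: "nat \<Rightarrow> nat"
    and S :: "nat \<Rightarrow> nat \<Rightarrow> real \<Rightarrow> 'a \<Rightarrow> real"
    and B D Y :: "nat \<Rightarrow> 'a \<Rightarrow> real"
    and r :: "nat \<Rightarrow> real"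
    and I :: "real \<Rightarrow> ereal"
    and l u :: ereal
    and d :: "nat \<Rightarrow> real"
    and q :: "nat \<Rightarrow> real \<Rightarrow> real"
  assumes "T > 0" and "a > 0"
    and "\<And>n. semi_complete_market T (P n) (F n) (G n) (H n) (dim n) (S n) (Q\<^sub>0 n) (B n) (D n) (Y n)"
    and "ld_assumption P Y r I"
    and "l < u"
    and "(\<lambda>n. essinf (P n) (\<lambda>\<omega>. ereal (Y n \<omega>))) \<longlonglongrightarrow> l"
    and "(\<lambda>n. esssup (P n) (\<lambda>\<omega>. ereal (Y n \<omega>))) \<longlonglongrightarrow> u"
  defines "d \<equiv> \<lambda>n. replication_cost (Q\<^sub>0 n) (D n)"
    and "q \<equiv> \<lambda>n price. optimal_quantity a (P n) (Y n) (d n) price"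
  shows
    "(l < 0 \<longrightarrow>
       (\<forall>p. l < ereal p \<and> p < 0 \<longrightarrow>
          liminf (\<lambda>n. ereal (q n (d n + p) / r n)) > 0 \<and>
          ((\<exists>y<p. I y < \<infinity>) \<longrightarrow> limsup (\<lambda>n. ereal (q n (d n + p) / r n)) < \<infinity>))) \<and>
     (u > 0 \<longrightarrow>
       (\<forall>p. 0 < p \<and> ereal p < u \<longrightarrow>
          limsup (\<lambda>n. ereal (q n (d n + p) / r n)) < 0 \<and>
          ((\<exists>y>p. I y < \<infinity>) \<longrightarrow> liminf (\<lambda>n. ereal (q n (d n + p) / r n)) > - \<infinity>)))"
proof -
  note ld = \<open>ld_assumption P Y r I\<close> and a = \<open>a > 0\<close>
  have LD: "large_deviations P Y r I" using ld by (simp add: ld_assumption_def)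
  have em: "exponential_moments (P n) (Y n)" for n
    using semi_complete_market_exponential_moments[OF assms(3)] LD by (simp add: large_deviations_def)
  note em' = exponential_moments_uminus[OF em] and ld' = ld_assumption_uminus[OF ld]
    and LD' = large_deviations_uminus[OF LD]
  have r: "\<forall>\<^sub>F n in sequentially. r n > 0"
    using LD by (auto simp: large_deviations_def filterlim_at_top_dense)
  have min: "shifted_mgf (P n) (Y n) p (- q n (d n + p) * a) \<le> shifted_mgf (P n) (Y n) p \<theta>"
    if "\<not> (AE \<omega> in P n. Y n \<omega> \<ge> p)" "\<not> (AE \<omega> in P n. Y n \<omega> \<le> p)" for n p \<theta>
    unfolding q_def using exponential_moments.optimal_quantity_minimizes[OF em a that] .
  have min': "shifted_mgf (P n) (\<lambda>\<omega>. - Y n \<omega>) (- p) (q n (d n + p) * a)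
      \<le> shifted_mgf (P n) (\<lambda>\<omega>. - Y n \<omega>) (- p) \<theta>"
    if "\<not> (AE \<omega> in P n. Y n \<omega> \<ge> p)" "\<not> (AE \<omega> in P n. Y n \<omega> \<le> p)" for n p \<theta>
    using min[OF that] by (simp add: shifted_mgf_uminus)
  have part1: "liminf (\<lambda>n. ereal (q n (d n + p) / r n)) > 0 \<and>
      ((\<exists>y<p. I y < \<infinity>) \<longrightarrow> limsup (\<lambda>n. ereal (q n (d n + p) / r n)) < \<infinity>)"
    if p: "l < ereal p" "p < 0" for p
  proof -
    note ev = eventually_not_AE_ge[OF em assms(6) p(1)] eventually_not_AE_le_neg[OF em ld p(2)]
    obtain \<epsilon> where \<epsilon>: "\<epsilon> > 0" "\<forall>\<^sub>F n in sequentially. \<forall>\<theta>.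
        (\<forall>\<theta>'. shifted_mgf (P n) (Y n) p \<theta> \<le> shifted_mgf (P n) (Y n) p \<theta>') \<longrightarrow> \<theta> \<le> - \<epsilon> * r n"
      using minimizers_below[OF em ld p(2)] by blast
    have "\<forall>\<^sub>F n in sequentially. ereal (\<epsilon> / a) \<le> ereal (q n (d n + p) / r n)"
      using \<epsilon>(2) ev r
    proof eventually_elim
      case (elim n)
      then have "- q n (d n + p) * a \<le> - \<epsilon> * r n" using min by blast
      then show ?case using elim a by (simp add: field_simps)
    qed
    then have "ereal (\<epsilon> / a) \<le> liminf (\<lambda>n. ereal (q n (d n + p) / r n))"
      by (rule Liminf_bounded)
    moreover have "0 < ereal (\<epsilon> / a)" using \<epsilon> a by simp
    ultimately have 1: "liminf (\<lambda>n. ereal (q n (d n + p) / r n)) > 0" by (meson less_le_trans)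
    have 2: "limsup (\<lambda>n. ereal (q n (d n + p) / r n)) < \<infinity>" if y: "y < p" "I y < \<infinity>" for y
    proof -
      obtain K where K: "\<forall>\<^sub>F n in sequentially. \<forall>\<theta>.
          (\<forall>\<theta>'. shifted_mgf (P n) (Y n) p \<theta> \<le> shifted_mgf (P n) (Y n) p \<theta>') \<longrightarrow> - K * r n \<le> \<theta>"
        using minimizers_above[where I = I, OF em LD y] by blast
      have "\<forall>\<^sub>F n in sequentially. ereal (q n (d n + p) / r n) \<le> ereal (K / a)"
        using K ev r
      proof eventually_elim
        case (elim n)
        then have "- K * r n \<le> - q n (d n + p) * a" using min by blast
        then show ?case using elim a by (simp add: field_simps)
      qed
      then have "limsup (\<lambda>n. ereal (q n (d n + p) / r n)) \<le> ereal (K / a)"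
        by (rule Limsup_bounded)
      then show ?thesis using le_less_trans by fastforce
    qed
    from 1 2 show ?thesis by blast
  qed
  have essinf': "(\<lambda>n. essinf (P n) (\<lambda>\<omega>. ereal (- Y n \<omega>))) \<longlonglongrightarrow> - u"
    using tendsto_uminus_ereal[OF assms(7)] by (simp add: essinf_def)
  have part2: "limsup (\<lambda>n. ereal (q n (d n + p) / r n)) < 0 \<and>
      ((\<exists>y>p. I y < \<infinity>) \<longrightarrow> liminf (\<lambda>n. ereal (q n (d n + p) / r n)) > - \<infinity>)"
    if p: "0 < p" "ereal p < u" for p
  proof -
    have p': "- u < ereal (- p)" "- p < 0" using p by (auto simp flip: uminus_ereal.simps)
    note ev = eventually_not_AE_ge[OF em' essinf' p'(1), unfolded neg_le_iff_le]
      eventually_not_AE_le_neg[OF em' ld' p'(2), unfolded neg_le_iff_le]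
    obtain \<epsilon> where \<epsilon>: "\<epsilon> > 0" "\<forall>\<^sub>F n in sequentially. \<forall>\<theta>.
        (\<forall>\<theta>'. shifted_mgf (P n) (\<lambda>\<omega>. - Y n \<omega>) (- p) \<theta> \<le> shifted_mgf (P n) (\<lambda>\<omega>. - Y n \<omega>) (- p) \<theta>')
        \<longrightarrow> \<theta> \<le> - \<epsilon> * r n"
      using minimizers_below[OF em' ld' p'(2)] by blast
    have "\<forall>\<^sub>F n in sequentially. ereal (q n (d n + p) / r n) \<le> ereal (- \<epsilon> / a)"
      using \<epsilon>(2) ev r
    proof eventually_elim
      case (elim n)
      then have "q n (d n + p) * a \<le> - \<epsilon> * r n" using min' by blast
      then show ?case using elim a by (simp add: field_simps)
    qed
    then have "limsup (\<lambda>n. ereal (q n (d n + p) / r n)) \<le> ereal (- \<epsilon> / a)"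
      by (rule Limsup_bounded)
    moreover have "ereal (- \<epsilon> / a) < 0" using \<epsilon> a by simp
    ultimately have 1: "limsup (\<lambda>n. ereal (q n (d n + p) / r n)) < 0" by (meson le_less_trans)
    have 2: "liminf (\<lambda>n. ereal (q n (d n + p) / r n)) > - \<infinity>" if y: "y > p" "I y < \<infinity>" for y
    proof -
      obtain K where K: "\<forall>\<^sub>F n in sequentially. \<forall>\<theta>.
          (\<forall>\<theta>'. shifted_mgf (P n) (\<lambda>\<omega>. - Y n \<omega>) (- p) \<theta> \<le> shifted_mgf (P n) (\<lambda>\<omega>. - Y n \<omega>) (- p) \<theta>')
          \<longrightarrow> - K * r n \<le> \<theta>"
        using minimizers_above[OF em' LD', of "- y" "- p"] y by auto
      have "\<forall>\<^sub>F n in sequentially. ereal (- K / a) \<le> ereal (q n (d n + p) / r n)"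
        using K ev r
      proof eventually_elim
        case (elim n)
        then have "- K * r n \<le> q n (d n + p) * a" using min' by blast
        then show ?case using elim a by (simp add: field_simps)
      qed
      then have "ereal (- K / a) \<le> liminf (\<lambda>n. ereal (q n (d n + p) / r n))"
        by (rule Liminf_bounded)
      then show ?thesis using less_le_trans by fastforce
    qed
    from 1 2 show ?thesis by blast
  qed
  from part1 part2 show ?thesis by blast
qed

end
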